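(* Let $w,u$ be words over $\{0,1\}$ of the same length $\ell\ge2$. Suppose $\lambda\in\mathbb{C}$ is an eigenvalue of $M(w,u)$ with $|\lambda|\ge2$ and $v\in\mathbb{C}^{\mathcal{O}_w(u)}\setminus\{0\}$ is a corresponding eigenvector. Then: (a) $|\lambda|=2$ and $v$ is an eigenvector of both $M_0(w,u)$ and $M_1(w,u)$ with eigenvalue $\lambda/2$; (b) all entries of $v$ are non-zero; (c) if $S_a(w)(u)=u$ and $T_a(w)(u)=0$ for some $a\in\{0,1\}$, then $\lambda=2$ and $v=cx$ for some $c\in\mathbb{C}$ and $x\in\{1,-1\}^{\mathcal{O}_w(u)}$.
   Context: For words $w=w_1\cdots w_\ell$, $u=u_1\cdots u_\ell$ over $\{0,1\}$ and $a\in\{0,1\}$: $T_a(w)(u)=1$ if $w_1=a$ and $u_1=1$, else $0$; $S_a(w)(u)\in\{0,1\}^\ell$ has $\ell$-th letter $u_\ell$ and $i$-th letter $u_i\oplus(u_{i+1}\wedge[w_{i+1}=a])$ for $1\le i\le\ell-1$ ($[\cdot]$ the indicator, $\oplus,\wedge$ XOR/AND). Each $S_a(w)$ is a bijection of $\{0,1\}^\ell$. For $h=h_1\cdots h_r$, $S_h(w)=S_{h_1}(w)\circ\cdots\circ S_{h_r}(w)$, and $\mathcal{O}_w(u)=\{S_h(w)(u):h\in\{0,1\}^*\}$. $M_a(w,u)$ is the matrix with rows and columns indexed by $\mathcal{O}_w(u)$ whose $(u',u'')$-entry is $(-1)^{T_a(w)(u')}$ if $S_a(w)(u')=u''$ and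 $0$ otherwise; $M(w,u)=M_0(w,u)+M_1(w,u)$. *)

theory Defs
  imports Complex_Main
begin

text \<open>Words over \<open>{0,1}\<close> are Boolean lists, with \<open>True\<close> for the letter 1 and \<open>False\<close> for the
  letter 0.  List positions start at 0, so the \<open>i\<close>-th letter of \<open>w\<close> is \<open>w ! (i - 1)\<close>.\<close>

type_synonym bword = "bool list"

definition Tval :: "bool \<Rightarrow> bword \<Rightarrow> bword \<Rightarrow> nat" where
  "Tval a w u = (if w ! 0 = a \<and> u ! 0 then 1 else 0)"

text \<open>On Booleans, \<open>\<noteq>\<close> is XOR.\<close>

definition Smap :: "bool \<Rightarrow> bword \<Rightarrow> bword \<Rightarrow> bword" where
  "Smap a w u =
     map (\<lambda>i. if i + 1 < length u then u ! i \<noteq> (u ! (i + 1) \<and> w ! (i + 1) = a) else u ! i)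
       [0..<length u]"

primrec Sword :: "bword \<Rightarrow> bword \<Rightarrow> bword \<Rightarrow> bword" where
  "Sword [] w = id"
| "Sword (a # h) w = Smap a w \<circ> Sword h w"

definition orb :: "bword \<Rightarrow> bword \<Rightarrow> bword set" where
  "orb w u = {Sword h w u | h. True}"

text \<open>A matrix with rows and columns indexed by a finite set \<open>I\<close> is a binary function, and a vector
  in \<open>\<complex>\<^sup>I\<close> is a unary function, of which only the values on \<open>I\<close> matter.\<close>

definition is_eigenvector ::
  "'i set \<Rightarrow> ('i \<Rightarrow> 'i \<Rightarrow> complex) \<Rightarrow> ('i \<Rightarrow> complex) \<Rightarrow> complex \<Rightarrow> bool" where
  "is_eigenvector I A v k \<longleftrightarrow>
     (\<exists>i\<in>I. v i \<noteq> 0) \<and> (\<forall>i\<in>I. (\<Sum>j\<in>I. A i j * v j) = k * v i)"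

text \<open>Entries outside the index set \<open>orb w u\<close> are set to 0; they are never used.\<close>

definition Mletter :: "bool \<Rightarrow> bword \<Rightarrow> bword \<Rightarrow> bword \<Rightarrow> bword \<Rightarrow> complex" where
  "Mletter a w u = (\<lambda>u' u''.
     if u' \<in> orb w u \<and> u'' \<in> orb w u \<and> Smap a w u' = u'' then (- 1) ^ Tval a w u' else 0)"

definition Mmat :: "bword \<Rightarrow> bword \<Rightarrow> bword \<Rightarrow> bword \<Rightarrow> complex" where
  "Mmat w u = (\<lambda>u' u''. Mletter False w u u' u'' + Mletter True w u u' u'')"

end

theory Submission
  imports Defs
begin

text \<open>
  The eigenvector equation reads \<open>k v(z) = \<plusminus>v(S\<^sub>0 z) \<plusminus> v(S\<^sub>1 z)\<close>. At an entry of maximal modulus the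
  triangle inequality is therefore an equality, so \<open>|k| = 2\<close>, and \<open>S\<^sub>0 z\<close> and \<open>S\<^sub>1 z\<close> carry maximal
  modulus again. As the \<open>S\<^sub>a\<close> permute the finite orbit, the set of such entries is closed under
  inverses too, hence is the whole orbit. Equality in the triangle inequality at every entry then
  forces \<open>\<plusminus>v(S\<^sub>a z) = (k/2) v(z)\<close> for both letters.
\<close>

text \<open>Parallelogram law: the squared norms of \<open>x - y\<close> and \<open>x + y\<close>
  add up to at most \<open>4 * m\<^sup>2\<close>, and \<open>x + y\<close> alone already accounts
  for that much.\<close>

lemma eq_if_norm_add_max:
  fixes x y :: complex
  assumes "cmod x \<le> m" "cmod y \<le> m" "2 * m \<le> cmod (x + y)"
  shows "x = y"
proof -
  have "0 \<le> m" using assms(1) norm_ge_zero[of x] by linarith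
  have "(cmod (x - y))\<^sup>2 + (cmod (x + y))\<^sup>2 = 2 * (cmod x)\<^sup>2 + 2 * (cmod y)\<^sup>2"
    unfolding cmod_power2 by (simp add: power2_eq_square algebra_simps)
  moreover have "(cmod x)\<^sup>2 \<le> m\<^sup>2" "(cmod y)\<^sup>2 \<le> m\<^sup>2" "(2 * m)\<^sup>2 \<le> (cmod (x + y))\<^sup>2"
    using assms \<open>0 \<le> m\<close> power_mono[OF assms(3), of 2] by (simp_all add: power_mono)
  ultimately have "(cmod (x - y))\<^sup>2 \<le> 0"
    unfolding power_mult_distrib power2_eq_square[of 2] by linarith
  then show ?thesis by simp
qed

lemma length_Smap [simp]: "length (Smap a w u) = length u"
  by (simp add: Smap_def)

lemma nth_Smap:
  assumes "i < length u"
  shows "Smap a w u ! i =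
    (if Suc i < length u then u ! i \<noteq> (u ! Suc i \<and> w ! Suc i = a) else u ! i)"
  using assms by (simp add: Smap_def)

lemma Smap_inj:
  assumes "length y = length z" "Smap a w y = Smap a w z"
  shows "y = z"
proof (rule nth_equalityI)
  fix i assume "i < length y"
  then have "i \<le> length y - 1" by simp
  \<comment> \<open>The last letter is kept, and the others are recovered from right to left.\<close>
  then show "y ! i = z ! i"
  proof (induction rule: inc_induct)
    case base
    have last: "length z - 1 < length z" "\<not> Suc (length z - 1) < length z"
      using \<open>i < length y\<close> assms(1) by auto
    have "Smap a w y ! (length z - 1) = Smap a w z ! (length z - 1)" using assms(2) by simp
    then show ?case unfolding assms(1) using last assms(1) by (simp add: nth_Smap del: One_nat_def)
  next
    case (step n)
    have "Smap a w y ! n = Smap a w z ! n" using assms(2) by simp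
    moreover have "Suc n < length y" "y ! Suc n = z ! Suc n" using step by auto
    ultimately show ?case using assms(1) by (auto simp: nth_Smap)
  qed
qed (fact assms(1))

lemma length_orb: "z \<in> orb w u \<Longrightarrow> length z = length u"
proof -
  have "length (Sword h w u) = length u" for h by (induction h) auto
  then show "z \<in> orb w u \<Longrightarrow> length z = length u" by (auto simp: orb_def)
qed

lemma finite_orb: "finite (orb w u)"
  by (rule finite_subset[OF _ finite_lists_length_eq[of UNIV "length u"]]) (auto dest: length_orb)

lemma orb_refl: "u \<in> orb w u"
  unfolding orb_def by (rule CollectI, rule exI[of _ "[]"]) simp

lemma orb_Smap:
  assumes "z \<in> orb w u"
  shows "Smap a w z \<in> orb w u"
proof -
  obtain h where "z = Sword h w u" using assms by (auto simp: orb_def)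
  then have "Smap a w z = Sword (a # h) w u" by simp
  then show ?thesis unfolding orb_def by blast
qed

lemma inj_on_Smap_orb: "inj_on (Smap a w) (orb w u)"
  by (rule inj_onI, rule Smap_inj) (simp_all add: length_orb[where w = w and u = u])

text \<open>The head letter of a word gives the outermost map of \<open>Sword\<close>, so list
  induction on the word adds one forward step at a time.\<close>

lemma orb_induct [consumes 1, case_names refl step]:
  assumes "z \<in> orb w u" "P u" "\<And>a z. z \<in> orb w u \<Longrightarrow> P z \<Longrightarrow> P (Smap a w z)"
  shows "P z"
proof -
  have "P (Sword h w u)" for h
  proof (induction h)
    case (Cons a h)
    have "Sword h w u \<in> orb w u" by (auto simp: orb_def)
    then show ?case using assms(3) Cons by simp
  qed (use assms(2) in simp)
  then show ?thesis using assms(1) by (auto simp: orb_def)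
qed

text \<open>An injective self-map of the finite set \<open>P\<close> is onto, so \<open>P\<close> is
  also closed under preimages within the orbit. Hence one can walk back from a point of
  \<open>P\<close> to \<open>u\<close>, and from \<open>u\<close> forward to every point.\<close>

lemma closed_subset_orb:
  assumes "P \<subseteq> orb w u" "P \<noteq> {}" "\<And>a z. z \<in> P \<Longrightarrow> Smap a w z \<in> P"
  shows "P = orb w u"
proof -
  have img: "Smap a w ` P = P" for a
  proof (rule endo_inj_surj)
    show "finite P" using assms(1) finite_orb by (rule finite_subset)
    show "inj_on (Smap a w) P" using inj_on_Smap_orb assms(1) by (rule inj_on_subset)
  qed (use assms(3) in blast)
  have pre: "z \<in> P" if z: "z \<in> orb w u" and Sz: "Smap a w z \<in> P" for a z
    using inj_on_image_mem_iff[OF inj_on_Smap_orb z assms(1), of a] Sz img[of a] by simp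
  obtain z where "z \<in> P" using assms(2) by blast
  then have "z \<in> orb w u" using assms(1) by blast
  \<comment> \<open>The implication is what survives the induction: membership of
    \<open>Smap a w z\<close> in \<open>P\<close> is pulled back to \<open>z\<close> by
    \<open>pre\<close>, then to \<open>u\<close> by the induction hypothesis.\<close>
  then have "z \<in> P \<longrightarrow> u \<in> P" by (induction rule: orb_induct) (blast dest: pre)+
  then have "u \<in> P" using \<open>z \<in> P\<close> by blast
  have "y \<in> P" if "y \<in> orb w u" for y
    using that by (induction rule: orb_induct) (auto simp: \<open>u \<in> P\<close> assms(3))
  then show ?thesis using assms(1) by blast
qed

lemma Mletter_mult:
  assumes "z \<in> orb w u"
  shows "(\<Sum>y\<in>orb w u. Mletter a w u z y * v y) = (- 1) ^ Tval a w z * v (Smap a w z)"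
proof -
  have "(\<Sum>y\<in>orb w u. Mletter a w u z y * v y) =
      (\<Sum>y\<in>orb w u. if Smap a w z = y then (- 1) ^ Tval a w z * v y else 0)"
    using assms by (intro sum.cong) (auto simp: Mletter_def)
  then show ?thesis using orb_Smap[OF assms] by (simp add: finite_orb)
qed

text \<open>The common modulus \<open>m\<close> is kept in the conclusion because its positivity
  makes every entry non-zero. The equations are stated entrywise so that they can be followed along
  the orbit.\<close>

lemma eigenvector_Mletter:
  assumes "is_eigenvector (orb w u) (Mmat w u) v k" "2 \<le> cmod k"
  obtains m where "cmod k = 2" "0 < m" "\<And>z. z \<in> orb w u \<Longrightarrow> cmod (v z) = m"
    "\<And>a z. z \<in> orb w u \<Longrightarrow> (- 1) ^ Tval a w z * v (Smap a w z) = k / 2 * v z"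
proof -
  \<comment> \<open>\<open>g a z\<close> is the entry at \<open>z\<close> of
    \<open>Mletter a w u\<close> applied to \<open>v\<close>, for \<open>z\<close> in the
    orbit.\<close>
  define g where "g a z = (- 1) ^ Tval a w z * v (Smap a w z)" for a z
  define m where "m = Max ((\<lambda>z. cmod (v z)) ` orb w u)"
  define P where "P = {z \<in> orb w u. cmod (v z) = m}"
  have cmod_g: "cmod (g a z) = cmod (v (Smap a w z))" for a z
    by (simp add: g_def norm_mult norm_power)
  have ev: "g False z + g True z = k * v z" if "z \<in> orb w u" for z
  proof -
    have "(\<Sum>y\<in>orb w u. Mmat w u z y * v y) = g False z + g True z"
      using that by (simp add: Mmat_def ring_distribs sum.distrib Mletter_mult g_def)
    then show ?thesis using assms(1) that by (simp add: is_eigenvector_def)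
  qed
  have le: "cmod (v z) \<le> m" if "z \<in> orb w u" for z
    unfolding m_def using that finite_orb by (intro Max_ge) auto
  have g_le: "cmod (g a z) \<le> m" if "z \<in> orb w u" for a z
    using le orb_Smap that by (simp add: cmod_g)
  obtain y where "y \<in> orb w u" "v y \<noteq> 0" using assms(1) by (auto simp: is_eigenvector_def)
  then have "0 < m" using le[of y] zero_less_norm_iff[of "v y"] by linarith
  have "m \<in> (\<lambda>z. cmod (v z)) ` orb w u"
    unfolding m_def using finite_orb orb_refl[of u w] by (intro Max_in) auto
  then obtain z0 where z0: "z0 \<in> P" unfolding P_def by blast
  have tri: "cmod k * m \<le> cmod (g False z) + cmod (g True z)" if "z \<in> P" for z
    using norm_triangle_ineq[of "g False z" "g True z"] ev that by (simp add: P_def norm_mult)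
  have two: "2 * m \<le> cmod k * m" using assms(2) \<open>0 < m\<close> by simp
  have "Smap a w z \<in> P" if "z \<in> P" for a z
  proof -
    have "z \<in> orb w u" using that by (simp add: P_def)
    \<comment> \<open>Two numbers that are at most \<open>m\<close> and sum to at least
      \<open>2 * m\<close> both equal \<open>m\<close>.\<close>
    then have "cmod (g a z) = m"
      using tri[OF that] two g_le[of z False] g_le[of z True] by (cases a) auto
    then show ?thesis using orb_Smap \<open>z \<in> orb w u\<close> by (simp add: P_def cmod_g)
  qed
  then have "P = orb w u" using z0 by (intro closed_subset_orb) (auto simp: P_def)
  then have const: "cmod (v z) = m" if "z \<in> orb w u" for z using that by (auto simp: P_def)
  have "cmod k * m \<le> 2 * m"
    using tri[OF z0] g_le[of z0 False] g_le[of z0 True] z0 by (simp add: P_def)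
  then have "cmod k = 2" using assms(2) \<open>0 < m\<close> by simp
  have "g a z = k / 2 * v z" if "z \<in> orb w u" for a z
  proof -
    have "cmod (g False z + g True z) = 2 * m"
      using ev const that \<open>cmod k = 2\<close> by (simp add: norm_mult)
    \<comment> \<open>The two summands coincide, so each is half of their sum
      \<open>k * v z\<close>.\<close>
    then have "g False z = g True z" using g_le that by (intro eq_if_norm_add_max[of _ m]) auto
    then show ?thesis using ev[OF that] by (cases a) (auto simp: field_simps)
  qed
  then show thesis using that \<open>cmod k = 2\<close> \<open>0 < m\<close> const by (simp add: g_def)
qed

theorem theorem5p1:
  fixes w u :: bword and k :: complex and v :: "bword \<Rightarrow> complex"
  assumes "length w = length u"
    and "length w \<ge> 2"
    and "is_eigenvector (orb w u) (Mmat w u) v k"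
    and "cmod k \<ge> 2"
  shows "(cmod k = 2 \<and>
          is_eigenvector (orb w u) (Mletter False w u) v (k / 2) \<and>
          is_eigenvector (orb w u) (Mletter True w u) v (k / 2)) \<and>
         (\<forall>z\<in>orb w u. v z \<noteq> 0) \<and>
         ((\<exists>a. Smap a w u = u \<and> Tval a w u = 0) \<longrightarrow>
           k = 2 \<and>
           (\<exists>(c::complex) (x :: bword \<Rightarrow> complex).
              (\<forall>z\<in>orb w u. x z \<in> {1, -1}) \<and> (\<forall>z\<in>orb w u. v z = c * x z)))"
proof -
  obtain m where m: "cmod k = 2" "0 < m" "\<And>z. z \<in> orb w u \<Longrightarrow> cmod (v z) = m"
    "\<And>a z. z \<in> orb w u \<Longrightarrow> (- 1) ^ Tval a w z * v (Smap a w z) = k / 2 * v z"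
    by (rule eigenvector_Mletter[OF assms(3,4)], rule that)
  have nz: "v z \<noteq> 0" if "z \<in> orb w u" for z using m(2) m(3)[OF that] by auto
  have ev: "is_eigenvector (orb w u) (Mletter a w u) v (k / 2)" for a
    using m(4) nz orb_refl[of u w] by (auto simp: is_eigenvector_def Mletter_mult)
  have "k = 2 \<and> (\<exists>c x. (\<forall>z\<in>orb w u. x z \<in> {1, -1}) \<and> (\<forall>z\<in>orb w u. v z = c * x z))"
    if fixed: "Smap a w u = u" "Tval a w u = 0" for a
  proof -
    \<comment> \<open>At the fixed point \<open>u\<close> with sign +1 the entrywise equation reads
      \<open>v u = k / 2 * v u\<close>.\<close>
    have "k = 2" using m(4)[OF orb_refl, of a] fixed nz[OF orb_refl] by simp
    \<comment> \<open>Normalizing by \<open>v u\<close> makes the ratio 1 at \<open>u\<close>. Since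
      \<open>k / 2 = 1\<close>, each application of some \<open>Smap b w\<close> changes the entry
      at most by a sign.\<close>
    have "v z / v u \<in> {1, -1}" if "z \<in> orb w u" for z
      using that
    proof (induction rule: orb_induct)
      case refl
      show ?case using nz[OF orb_refl] by simp
    next
      case (step b z)
      have "v (Smap b w z) = v z \<or> v (Smap b w z) = - v z"
        using m(4)[OF step(1), of b] \<open>k = 2\<close>
        by (cases "Tval b w z = 0")
          (auto simp: Tval_def minus_equation_iff[of "v (Smap b w z)"] split: if_splits)
      then have "v (Smap b w z) / v u \<in> {v z / v u, - (v z / v u)}" by auto
      then show ?case using step(2) by (elim insertE emptyE) simp_all
    qed
    then have "\<forall>z\<in>orb w u. v z / v u \<in> {1, -1}" by blast
    moreover have "\<forall>z\<in>orb w u. v z = v u * (v z / v u)" using nz[OF orb_refl] by simp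
    ultimately show ?thesis
      using \<open>k = 2\<close> by (intro conjI exI[of _ "v u"] exI[of _ "\<lambda>z. v z / v u"])
  qed
  then show ?thesis using m(1) ev nz by blast
qed

end
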